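(* Let $A_1,\dots,A_m,B_1,B_2$ be real symmetric $n\times n$ matrices, let $c_1,c_2\in\mathbb{R}$, and put $h_1(x)=x^TB_1x-c_1$, $h_2(x)=x^TB_2x-c_2$ for $x\in\mathbb{R}^n$. Let $T\subseteq\mathbb{R}^n$ and $$V=\{(x^TA_1x,\dots,x^TA_mx): x\in T\}\subset\mathbb{R}^m,$$ and assume $V\neq\emptyset$. Then: (a) If $T=E(h_1)\cap E(h_2)$ and there exists $(\mu_1,\mu_2)\in\mathbb{R}\times\mathbb{R}$ with $\mu_1B_1+\mu_2B_2\prec 0$, then $$\mathrm{conv}(V)=\{(A_1\bullet X,\dots,A_m\bullet X): X\succeq 0,\ B_1\bullet X=c_1,\ B_2\bullet X=c_2\}.$$ (b) If $T=S(h_1)\cap E(h_2)$ and there exists $(\mu_1,\mu_2)\in\mathbb{R}_+\times\mathbb{R}$ with $\mu_1B_1+\mu_2B_2\prec 0$, then $$\mathrm{conv}(V)=\{(A_1\bullet X,\dots,A_m\bullet X): X\succeq 0,\ B_1\bullet X\ge c_1,\ B_2\bullet X=c_2\}.$$ (c) If $T=E(h_1)\cap S(h_2)$ and there exists $(\mu_1,\mu_2)\in\mathbb{R}\times\mathbb{R}_+$ with $\mu_1B_1+\mu_2B_2\prec 0$, then $$\mathrm{conv}(V)=\{(A_1\bullet X,\dots,A_m\bullet X): X\succeq 0,\ B_1\bullet X=c_1,\ B_2\bullet X\ge c_2\}.$$ (d) If $T=S(h_1)\cap S(h_2)$ and there exists $(\mu_1,\mu_2)\in\mathbb{R}_+\times\mathbb{R}_+$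 with $\mu_1B_1+\mu_2B_2\prec 0$, then $$\mathrm{conv}(V)=\{(A_1\bullet X,\dots,A_m\bullet X): X\succeq 0,\ B_1\bullet X\ge c_1,\ B_2\bullet X\ge c_2\}.$$ In each case $X$ ranges over real symmetric $n\times n$ matrices.
   Context: For a function $h$ on $\mathbb{R}^n$, $S(h)=\{x\in\mathbb{R}^n: h(x)\ge 0\}$ and $E(h)=\{x\in\mathbb{R}^n: h(x)=0\}$. $\mathbb{R}_+$ is the set of nonnegative real numbers. $A\bullet B=\mathrm{trace}(A^TB)$ is the Frobenius inner product. For a symmetric matrix $M$, $M\succeq 0$ means positive semidefinite and $M\prec 0$ means negative definite. $\mathrm{conv}(K)$ is the convex hull of $K$. *)

theory Defs
  imports "HOL-Analysis.Analysis"
begin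

definition superlevel_set :: "(real ^ 'n \<Rightarrow> real) \<Rightarrow> (real ^ 'n) set"
  where "superlevel_set h = {x. h x \<ge> 0}"

definition zero_set :: "(real ^ 'n \<Rightarrow> real) \<Rightarrow> (real ^ 'n) set"
  where "zero_set h = {x. h x = 0}"

definition symmetric_matrix :: "real ^ 'n ^ 'n \<Rightarrow> bool"
  where "symmetric_matrix M \<longleftrightarrow> transpose M = M"

definition quad_form :: "real ^ 'n ^ 'n \<Rightarrow> real ^ 'n \<Rightarrow> real"
  where "quad_form M x = x \<bullet> (M *v x)"

definition frobenius_inner :: "real ^ 'n ^ 'n \<Rightarrow> real ^ 'n ^ 'n \<Rightarrow> real"
  where "frobenius_inner M N = trace (transpose M ** N)"

text \<open>Both definiteness notions include symmetry of the matrix.\<close>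

definition positive_semidefinite :: "real ^ 'n ^ 'n \<Rightarrow> bool"
  where "positive_semidefinite M \<longleftrightarrow>
    symmetric_matrix M \<and> (\<forall>x. quad_form M x \<ge> 0)"

definition negative_definite :: "real ^ 'n ^ 'n \<Rightarrow> bool"
  where "negative_definite M \<longleftrightarrow>
    symmetric_matrix M \<and> (\<forall>x. x \<noteq> 0 \<longrightarrow> quad_form M x < 0)"

end

theory Submission
  imports Defs
begin

text \<open>
  The map \<open>x \<mapsto> x x\<^sup>T\<close> turns quadratic forms into linear ones:
  \<open>x\<^sup>T M x\<close> is the Frobenius product of \<open>M\<close> with \<open>x x\<^sup>T\<close>. So both sides of each claim are images,
  under one linear map, of sets of matrices, and it suffices to show that the set of feasible positive
  semidefinite matrices (\<open>spectrahedron\<close> below) is the convex hull of the feasible matrices of the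
  form \<open>x x\<^sup>T\<close>.

  By the Krein--Milman--Minkowski theorem a compact convex set is the convex hull of its extreme
  points, so two facts are needed.

  \<^item> Extreme points have rank at most one (\<open>extreme_point_rank_one\<close>). A positive semidefinite matrix
  of larger rank can be written \<open>u u\<^sup>T + z z\<^sup>T + Z\<close> with \<open>u, z\<close> independent and \<open>Z\<close> positive
  semidefinite. The symmetric matrices built from \<open>u\<close> and \<open>z\<close> form a space of dimension three,
  while only two linear quantities are constrained; hence some nonzero direction \<open>D\<close> in this space
  leaves both of them unchanged, and a short step along \<open>D\<close> or \<open>-D\<close> keeps the matrix positive
  semidefinite (\<open>feasible_perturbation\<close>).

  \<^item> The feasible set is compact (\<open>compact_spectrahedron\<close>). A positive definite \<open>N\<close> satisfies
  \<open>d * trace X \<le> N \<bullet> X\<close> on the positive semidefinite cone for some \<open>d > 0\<close>. Applied to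
  \<open>N = -(\<mu>\<^sub>1 B\<^sub>1 + \<mu>\<^sub>2 B\<^sub>2)\<close> this bounds the trace, hence the norm, as soon as
  \<open>\<mu>\<^sub>1 s + \<mu>\<^sub>2 t\<close> is bounded below over the admissible values \<open>(s, t)\<close> of \<open>(B\<^sub>1 \<bullet> X, B\<^sub>2 \<bullet> X)\<close>; the
  sign conditions on the multipliers of inequality constraints guarantee exactly that.

  All four claims come from one statement, \<open>convex_hull_joint_quadratic_image\<close>, in which the admissible
  values form an arbitrary closed convex subset \<open>K\<close> of the plane.
\<close>

section \<open>Quadratic forms and rank-one matrices\<close>

definition outer :: "real ^ 'n \<Rightarrow> real ^ 'n \<Rightarrow> real ^ 'n ^ 'n"
  where "outer u v = (\<chi> i j. u $ i * v $ j)"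

lemma outer_mult_vec: "outer u v *v x = (v \<bullet> x) *\<^sub>R u"
  by (simp add: vec_eq_iff outer_def matrix_vector_mult_def inner_vec_def sum_distrib_left mult_ac)

lemma frobenius_inner_eq_inner: "frobenius_inner M N = M \<bullet> N"
proof -
  have "frobenius_inner M N = (\<Sum>i\<in>UNIV. \<Sum>k\<in>UNIV. M $ k $ i * N $ k $ i)"
    by (simp add: frobenius_inner_def trace_def transpose_def matrix_matrix_mult_def)
  also have "\<dots> = M \<bullet> N"
    by (subst sum.swap) (simp add: inner_vec_def)
  finally show ?thesis .
qed

lemma quad_form_eq_inner_outer: "quad_form M x = M \<bullet> outer x x"
  by (simp add: quad_form_def inner_vec_def outer_def matrix_vector_mult_def sum_distrib_left mult_ac)

lemma quad_form_outer: "quad_form (outer u v) x = (u \<bullet> x) * (v \<bullet> x)"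
  by (simp add: quad_form_def outer_mult_vec inner_commute)

lemma quad_form_linear:
  "quad_form (M + N) x = quad_form M x + quad_form N x"
  "quad_form (M - N) x = quad_form M x - quad_form N x"
  "quad_form (r *\<^sub>R M) x = r * quad_form M x"
  by (simp_all add: quad_form_eq_inner_outer inner_add_left inner_diff_left)

lemma symmetric_matrix_linear:
  "symmetric_matrix M \<Longrightarrow> symmetric_matrix N \<Longrightarrow> symmetric_matrix (M + N)"
  "symmetric_matrix M \<Longrightarrow> symmetric_matrix N \<Longrightarrow> symmetric_matrix (M - N)"
  "symmetric_matrix M \<Longrightarrow> symmetric_matrix (r *\<^sub>R M)"
  by (simp_all add: symmetric_matrix_def transpose_def vec_eq_iff)

lemma symmetric_matrix_outer:
  "symmetric_matrix (outer u u)" "symmetric_matrix (outer u v + outer v u)"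
  by (simp_all add: symmetric_matrix_def transpose_def vec_eq_iff outer_def mult_ac add_ac)

lemma symmetric_matrix_inner_swap:
  assumes "symmetric_matrix M"
  shows "x \<bullet> (M *v y) = y \<bullet> (M *v x)"
  using assms
  by (metis symmetric_matrix_def dot_matrix_vector_mul inner_commute dot_lmul_matrix transpose_matrix_vector)

section \<open>The positive semidefinite cone\<close>

lemma positive_semidefinite_outer: "positive_semidefinite (outer u u)"
  by (simp add: positive_semidefinite_def symmetric_matrix_outer quad_form_outer)

lemma positive_semidefinite_add:
  "positive_semidefinite M \<Longrightarrow> positive_semidefinite N \<Longrightarrow> positive_semidefinite (M + N)"
  by (simp add: positive_semidefinite_def symmetric_matrix_linear quad_form_linear)

lemma positive_semidefinite_scaleR:
  "positive_semidefinite M \<Longrightarrow> r \<ge> 0 \<Longrightarrow> positive_semidefinite (r *\<^sub>R M)"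
  by (simp add: positive_semidefinite_def symmetric_matrix_linear quad_form_linear)

lemma positive_semidefinite_Cauchy_Schwarz:
  assumes "positive_semidefinite X"
  shows "(x \<bullet> (X *v v))\<^sup>2 \<le> quad_form X x * quad_form X v"
proof -
  have sym: "symmetric_matrix X" and nonneg: "\<And>y. quad_form X y \<ge> 0"
    using assms by (auto simp: positive_semidefinite_def)
  define p s t where "p = x \<bullet> (X *v v)" and "s = quad_form X x" and "t = quad_form X v"
  have expand: "quad_form X (a *\<^sub>R x - b *\<^sub>R v) = a\<^sup>2 * s - 2 * a * b * p + b\<^sup>2 * t"
    for a b
    using symmetric_matrix_inner_swap[OF sym, of x v]
    by (simp add: quad_form_def p_def s_def t_def matrix_vector_mult_diff_distrib matrix_vector_mult_scaleR
        inner_diff_left inner_diff_right power2_eq_square algebra_simps)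
  have st: "s \<ge> 0" "t \<ge> 0" using nonneg by (auto simp: s_def t_def)
  have "p\<^sup>2 \<le> s * t"
  proof (cases "t = 0")
    case True
    \<comment> \<open>With \<open>t = 0\<close> the form is affine in the coefficient of \<open>v\<close>; taking the coefficients \<open>p\<close> and
      \<open>s + 1\<close> makes it negative unless \<open>p = 0\<close>.\<close>
    have "0 \<le> p\<^sup>2 * s - 2 * p * (s + 1) * p"
      using nonneg[of "p *\<^sub>R x - (s + 1) *\<^sub>R v"] expand[of p "s + 1"] True by simp
    also have "\<dots> = - (s + 2) * p\<^sup>2" by (simp add: power2_eq_square algebra_simps)
    finally have "p\<^sup>2 \<le> 0" using st(1) by (simp add: zero_le_mult_iff)
    then show ?thesis using True by simp
  next
    case False
    have "0 \<le> t\<^sup>2 * s - 2 * t * p * p + p\<^sup>2 * t"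
      using nonneg[of "t *\<^sub>R x - p *\<^sub>R v"] expand[of t p] by simp
    also have "\<dots> = t * (s * t - p\<^sup>2)" by (simp add: power2_eq_square algebra_simps)
    finally show ?thesis using st(2) False by (simp add: zero_le_mult_iff)
  qed
  then show ?thesis by (simp add: p_def s_def t_def)
qed

text \<open>Cauchy--Schwarz for the basis vectors bounds an entry by the geometric mean of two diagonal
  entries, each of which is at most the trace because the diagonal is nonnegative. This is what makes
  bounds on the trace give bounds on the whole matrix.\<close>

lemma positive_semidefinite_entry_le_trace:
  assumes "positive_semidefinite X"
  shows "\<bar>X $ i $ j\<bar> \<le> trace X"
proof -
  have diag: "quad_form X (axis k 1) = X $ k $ k" for k
    by (simp add: quad_form_def matrix_vector_mul_component inner_axis' matrix_vector_mult_basis column_def)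
  then have pos: "X $ k $ k \<ge> 0" for k
    using assms by (metis positive_semidefinite_def)
  have le: "X $ k $ k \<le> trace X" for k
    unfolding trace_def using pos by (intro member_le_sum) auto
  have "(axis i 1) \<bullet> (X *v axis j 1) = X $ i $ j"
    by (simp add: inner_axis' matrix_vector_mult_basis column_def)
  then have "(X $ i $ j)\<^sup>2 \<le> X $ i $ i * X $ j $ j"
    using positive_semidefinite_Cauchy_Schwarz[OF assms, of "axis i 1" "axis j 1"] by (simp add: diag)
  also have "\<dots> \<le> (trace X)\<^sup>2"
    unfolding power2_eq_square using le pos by (intro mult_mono) (auto intro: order_trans)
  finally show ?thesis
    using le[of i] pos[of i] by (simp add: abs_le_square_iff[symmetric])
qed

lemma norm_le_trace:
  fixes X :: "real ^ 'n ^ 'n"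
  assumes "positive_semidefinite X"
  shows "norm X \<le> (real CARD('n))\<^sup>2 * trace X"
proof -
  have "norm X \<le> (\<Sum>i\<in>UNIV. norm (X $ i))"
    unfolding norm_vec_def by (rule L2_set_le_sum) simp
  also have "\<dots> \<le> (\<Sum>i\<in>(UNIV::'n set). \<Sum>j\<in>(UNIV::'n set). \<bar>X $ i $ j\<bar>)"
    by (intro sum_mono norm_le_l1_cart)
  also have "\<dots> \<le> (\<Sum>i\<in>(UNIV::'n set). \<Sum>j\<in>(UNIV::'n set). trace X)"
    by (intro sum_mono positive_semidefinite_entry_le_trace assms)
  also have "\<dots> = (real CARD('n))\<^sup>2 * trace X"
    by (simp add: power2_eq_square)
  finally show ?thesis .
qed

lemma positive_semidefinite_eq_0:
  assumes "positive_semidefinite X" "\<And>v. quad_form X v \<le> 0"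
  shows "X = 0"
proof -
  have "X $ i $ j = 0" for i j
  proof -
    have "axis i 1 \<bullet> (X *v axis j 1) = 0"
      using positive_semidefinite_Cauchy_Schwarz[OF assms(1), of "axis i 1" "axis j 1"] assms
      by (metis antisym mult_zero_left positive_semidefinite_def power2_less_eq_zero_iff)
    then show ?thesis
      by (simp add: inner_axis' matrix_vector_mult_basis column_def)
  qed
  then show ?thesis by (simp add: vec_eq_iff)
qed

text \<open>One step of a Cholesky-type elimination: with \<open>u = X v / sqrt (v\<^sup>T X v)\<close> the difference
  \<open>X - u u\<^sup>T\<close> is again positive semidefinite, which is precisely Cauchy--Schwarz for \<open>X\<close>. That \<open>v\<close>
  enters the kernel of the difference is recorded because it forces the vector peeled off in the
  next step to be independent of \<open>u\<close>.\<close>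

lemma peel_rank_one:
  assumes psd: "positive_semidefinite X" and "X \<noteq> 0"
  obtains v u where "v \<bullet> u > 0" "positive_semidefinite (X - outer u u)" "(X - outer u u) *v v = 0"
proof -
  obtain v where v: "quad_form X v > 0"
    using positive_semidefinite_eq_0[OF psd] \<open>X \<noteq> 0\<close> by (meson not_le)
  define s where "s = quad_form X v"
  define u where "u = (1 / sqrt s) *\<^sub>R (X *v v)"
  have s: "s > 0" "v \<bullet> (X *v v) = s" using v by (auto simp: s_def quad_form_def)
  have vu: "v \<bullet> u = sqrt s"
    using s by (simp add: u_def real_div_sqrt)
  have "positive_semidefinite (X - outer u u)"
    unfolding positive_semidefinite_def
  proof (intro conjI allI)
    show "symmetric_matrix (X - outer u u)"
      using psd by (simp add: positive_semidefinite_def symmetric_matrix_linear symmetric_matrix_outer)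
    fix x
    have "(u \<bullet> x) * (u \<bullet> x) = (x \<bullet> (X *v v))\<^sup>2 / s"
      using s by (simp add: u_def power2_eq_square inner_commute)
    also have "\<dots> \<le> quad_form X x"
      using positive_semidefinite_Cauchy_Schwarz[OF psd, of x v] s(1)
      by (simp add: s_def divide_le_eq mult.commute)
    finally show "0 \<le> quad_form (X - outer u u) x"
      by (simp add: quad_form_linear quad_form_outer)
  qed
  moreover have "(X - outer u u) *v v = 0"
    using s vu by (simp add: matrix_vector_mult_diff_rdistrib outer_mult_vec inner_commute)
       (simp add: u_def)
  ultimately show ?thesis
    using that[of v u] vu s by simp
qed

section \<open>Extreme points have rank at most one\<close>

text \<open>The normalisation fixes the length of the perturbation below, so that no separate small step
  size has to be chosen.\<close>

lemma two_equations_three_unknowns: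
  fixes p q :: "real \<times> real \<times> real"
  obtains a b c :: real where "\<bar>a\<bar> + \<bar>b\<bar> + \<bar>c\<bar> = 1"
    "p \<bullet> (a, b, c) = 0" "q \<bullet> (a, b, c) = 0"
proof -
  have "dim {p, q} \<le> card {p, q}" by (rule dim_le_card') simp
  also have "\<dots> < DIM(real \<times> real \<times> real)" by (simp add: card_insert_if)
  finally obtain d where d: "d \<noteq> 0" "span {p, q} \<subseteq> {x. d \<bullet> x = 0}"
    using lowdim_subset_hyperplane by blast
  obtain a b c where abc: "d = (a, b, c)" by (cases d)
  define r where "r = \<bar>a\<bar> + \<bar>b\<bar> + \<bar>c\<bar>"
  have "a \<noteq> 0 \<or> b \<noteq> 0 \<or> c \<noteq> 0" using d(1) by (auto simp: abc zero_prod_def)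
  then have r: "r > 0" by (auto simp: r_def add_pos_nonneg add_nonneg_pos)
  have "d \<bullet> p = 0" "d \<bullet> q = 0"
    using d(2) span_base[of p "{p, q}"] span_base[of q "{p, q}"] by blast+
  moreover have "(a / r, b / r, c / r) = (1 / r) *\<^sub>R d"
    by (simp add: abc)
  moreover have "\<bar>a / r\<bar> + \<bar>b / r\<bar> + \<bar>c / r\<bar> = 1"
    using r by (simp add: r_def abs_divide add_divide_distrib[symmetric])
  ultimately show ?thesis
    using that[of "a / r" "b / r" "c / r"] by (simp add: inner_commute[of _ d])
qed

lemma binary_form_bound:
  fixes a b c s t :: real
  assumes "\<bar>a\<bar> + \<bar>b\<bar> + \<bar>c\<bar> \<le> 1"
  shows "\<bar>a * (s * s) + 2 * b * (s * t) + c * (t * t)\<bar> \<le> s * s + t * t"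
proof -
  have st: "\<bar>2 * (s * t)\<bar> \<le> s * s + t * t"
    using sum_squares_bound[of s t] sum_squares_bound[of s "-t"]
    by (simp add: abs_le_iff power2_eq_square mult_ac)
  have "\<bar>a * (s * s) + 2 * b * (s * t) + c * (t * t)\<bar>
      \<le> \<bar>a\<bar> * (s * s) + \<bar>b\<bar> * \<bar>2 * (s * t)\<bar> + \<bar>c\<bar> * (t * t)"
    by (rule order_trans[OF abs_triangle_ineq] add_mono)+ (auto simp: abs_mult)
  also have "\<dots> \<le> \<bar>a\<bar> * (s * s + t * t) + \<bar>b\<bar> * (s * s + t * t) + \<bar>c\<bar> * (s * s + t * t)"
    using st by (intro add_mono mult_left_mono) auto
  also have "\<dots> = (\<bar>a\<bar> + \<bar>b\<bar> + \<bar>c\<bar>) * (s * s + t * t)" by (simp add: algebra_simps)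
  also have "\<dots> \<le> s * s + t * t"
    using assms by (intro mult_left_le_one_le) auto
  finally show ?thesis .
qed

text \<open>Two peeling steps give \<open>X = u u\<^sup>T + z z\<^sup>T + Z\<close>. The perturbation
  \<open>a u u\<^sup>T + b (u z\<^sup>T + z u\<^sup>T) + c z z\<^sup>T\<close> has three free coefficients against two linear equations, and
  with small coefficients its form is dominated by that of \<open>u u\<^sup>T + z z\<^sup>T\<close>.\<close>

lemma feasible_perturbation:
  fixes B\<^sub>1 B\<^sub>2 X :: "real ^ 'n ^ 'n"
  assumes psd: "positive_semidefinite X" and not_rank1: "\<And>x. X \<noteq> outer x x"
  obtains D where "D \<noteq> 0" "B\<^sub>1 \<bullet> D = 0" "B\<^sub>2 \<bullet> D = 0"
    "positive_semidefinite (X + D)" "positive_semidefinite (X - D)"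
proof -
  have "outer 0 0 = (0 :: real ^ 'n ^ 'n)" by (simp add: outer_def vec_eq_iff)
  then have "X \<noteq> 0" using not_rank1 by metis
  then obtain v u where vu: "v \<bullet> u > 0" and Y: "positive_semidefinite (X - outer u u)"
    and Yv: "(X - outer u u) *v v = 0"
    using peel_rank_one[OF psd] by blast
  have "X - outer u u \<noteq> 0" using not_rank1 by simp
  then obtain w z where wz: "w \<bullet> z > 0" and Z: "positive_semidefinite (X - outer u u - outer z z)"
    using peel_rank_one[OF Y] by blast
  \<comment> \<open>Since \<open>v\<close> is in the kernel of \<open>X - u u\<^sup>T\<close>, subtracting \<open>z z\<^sup>T\<close> must not make the form
    negative at \<open>v\<close>.\<close>
  have zv: "z \<bullet> v = 0"
  proof -
    have "0 \<le> quad_form (X - outer u u - outer z z) v" using Z by (simp add: positive_semidefinite_def)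
    also have "\<dots> = - (z \<bullet> v)\<^sup>2"
      using Yv by (simp add: quad_form_linear(2)[of "X - outer u u"] quad_form_outer power2_eq_square)
         (simp add: quad_form_def)
    finally show ?thesis by simp
  qed
  obtain a b c where abc: "\<bar>a\<bar> + \<bar>b\<bar> + \<bar>c\<bar> = 1"
    "(B\<^sub>1 \<bullet> outer u u, B\<^sub>1 \<bullet> (outer u z + outer z u), B\<^sub>1 \<bullet> outer z z) \<bullet> (a, b, c) = 0"
    "(B\<^sub>2 \<bullet> outer u u, B\<^sub>2 \<bullet> (outer u z + outer z u), B\<^sub>2 \<bullet> outer z z) \<bullet> (a, b, c) = 0"
    using two_equations_three_unknowns by blast
  define D where "D = a *\<^sub>R outer u u + b *\<^sub>R (outer u z + outer z u) + c *\<^sub>R outer z z"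
  have qD: "quad_form D x = a * ((u \<bullet> x) * (u \<bullet> x)) + 2 * b * ((u \<bullet> x) * (z \<bullet> x)) + c * ((z \<bullet> x) * (z \<bullet> x))" for x
    by (simp add: D_def quad_form_linear quad_form_outer algebra_simps)
  have bound: "\<bar>quad_form D x\<bar> \<le> quad_form X x" for x
  proof -
    have "\<bar>quad_form D x\<bar> \<le> (u \<bullet> x) * (u \<bullet> x) + (z \<bullet> x) * (z \<bullet> x)"
      unfolding qD by (rule binary_form_bound) (simp add: abc)
    also have "\<dots> \<le> quad_form X x"
    proof -
      have "0 \<le> quad_form (X - outer u u - outer z z) x"
        using Z unfolding positive_semidefinite_def by blast
      then show ?thesis by (simp add: quad_form_linear quad_form_outer)
    qed
    finally show ?thesis .
  qed
  have symD: "symmetric_matrix D"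
    unfolding D_def by (intro symmetric_matrix_linear symmetric_matrix_outer)
  \<comment> \<open>The vectors \<open>v, w\<close> act as test vectors: \<open>v\<close> sees \<open>u\<close> but not \<open>z\<close>, and \<open>w\<close> sees \<open>z\<close>, so
    evaluating the bilinear form of \<open>D\<close> on them recovers the coefficients one after the other.\<close>
  have "D \<noteq> 0"
  proof
    assume "D = 0"
    then have Dx: "x \<bullet> (D *v y) = 0" for x y by simp
    have expand: "x \<bullet> (D *v y) = a * ((u \<bullet> x) * (u \<bullet> y))
        + b * ((u \<bullet> x) * (z \<bullet> y) + (z \<bullet> x) * (u \<bullet> y)) + c * ((z \<bullet> x) * (z \<bullet> y))" for x y
      by (simp add: D_def matrix_vector_mult_add_rdistrib scaleR_matrix_vector_assoc[symmetric]
          outer_mult_vec inner_add_right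
           inner_commute algebra_simps)
    have uv: "u \<bullet> v \<noteq> 0" and zw: "z \<bullet> w \<noteq> 0" using vu wz by (auto simp: inner_commute)
    have "a = 0" using Dx[of v v] uv by (simp add: expand zv)
    moreover have "b = 0" using Dx[of v w] uv zw \<open>a = 0\<close> by (simp add: expand zv)
    moreover have "c = 0" using Dx[of w w] zw calculation by (simp add: expand)
    ultimately show False using abc(1) by simp
  qed
  moreover have "B\<^sub>1 \<bullet> D = 0" "B\<^sub>2 \<bullet> D = 0"
    using abc(2,3) by (simp_all add: D_def inner_add_right mult.commute)
  moreover have "positive_semidefinite (X + D)" "positive_semidefinite (X - D)"
  proof -
    have "0 \<le> quad_form X x + quad_form D x" "0 \<le> quad_form X x - quad_form D x" for x
      using bound[of x] by linarith+
    then show "positive_semidefinite (X + D)" "positive_semidefinite (X - D)"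
      using psd symD
      by (simp_all add: positive_semidefinite_def symmetric_matrix_linear quad_form_linear)
  qed
  ultimately show ?thesis using that by blast
qed

text \<open>Equality and inequality constraints are treated alike by letting the pair of constrained values
  range over a set \<open>K\<close>.\<close>

definition spectrahedron ::
  "real ^ 'n ^ 'n \<Rightarrow> real ^ 'n ^ 'n \<Rightarrow> (real \<times> real) set \<Rightarrow> (real ^ 'n ^ 'n) set"
  where "spectrahedron B\<^sub>1 B\<^sub>2 K = {X. positive_semidefinite X \<and> (B\<^sub>1 \<bullet> X, B\<^sub>2 \<bullet> X) \<in> K}"

lemma extreme_point_rank_one:
  assumes "X extreme_point_of spectrahedron B\<^sub>1 B\<^sub>2 K"
  obtains x where "X = outer x x"
proof (rule ccontr)
  assume "\<not> thesis"
  with that have nr: "\<And>x. X \<noteq> outer x x" by blast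
  have X: "positive_semidefinite X" "(B\<^sub>1 \<bullet> X, B\<^sub>2 \<bullet> X) \<in> K"
    using assms by (auto simp: extreme_point_of_def spectrahedron_def)
  obtain D where D: "D \<noteq> 0" "B\<^sub>1 \<bullet> D = 0" "B\<^sub>2 \<bullet> D = 0"
    "positive_semidefinite (X + D)" "positive_semidefinite (X - D)"
    using feasible_perturbation[OF X(1) nr] by blast
  have mem: "X + D \<in> spectrahedron B\<^sub>1 B\<^sub>2 K" "X - D \<in> spectrahedron B\<^sub>1 B\<^sub>2 K"
    using D X by (simp_all add: spectrahedron_def inner_add_right inner_diff_right)
  have "X + D \<noteq> X - D" 
  proof
    assume "X + D = X - D"
    then have "2 *\<^sub>R D = 0" by (simp add: scaleR_2 algebra_simps)
    then show False using D(1) by simp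
  qed
  moreover have "midpoint (X + D) (X - D) = X" by (simp add: midpoint_def scaleR_2[symmetric])
  ultimately have "X \<in> open_segment (X + D) (X - D)"
    using midpoint_in_open_segment by metis
  then show False using assms mem by (auto simp: extreme_point_of_def)
qed

section \<open>Compact spectrahedra are hulls of rank-one matrices\<close>

lemma closed_positive_semidefinite: "closed {X :: real ^ 'n ^ 'n. positive_semidefinite X}"
proof -
  have "{X :: real ^ 'n ^ 'n. positive_semidefinite X} =
      (\<Inter>i. \<Inter>j. {X. X $ j $ i = X $ i $ j}) \<inter> (\<Inter>x. {X. 0 \<le> X \<bullet> outer x x})"
    by (auto simp: positive_semidefinite_def symmetric_matrix_def transpose_def vec_eq_iff quad_form_eq_inner_outer)
  also have "closed \<dots>"
    by (intro closed_Int closed_INT ballI closed_Collect_eq closed_Collect_le continuous_intros)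
  finally show ?thesis .
qed

lemma closed_spectrahedron:
  assumes "closed K"
  shows "closed (spectrahedron B\<^sub>1 B\<^sub>2 K)"
proof -
  have "closed ((\<lambda>X. (B\<^sub>1 \<bullet> X, B\<^sub>2 \<bullet> X)) -` K)"
    by (intro continuous_closed_vimage assms allI continuous_intros)
  then have "closed ({X. positive_semidefinite X} \<inter> (\<lambda>X. (B\<^sub>1 \<bullet> X, B\<^sub>2 \<bullet> X)) -` K)"
    by (intro closed_Int closed_positive_semidefinite)
  moreover have "{X. positive_semidefinite X} \<inter> (\<lambda>X. (B\<^sub>1 \<bullet> X, B\<^sub>2 \<bullet> X)) -` K = spectrahedron B\<^sub>1 B\<^sub>2 K"
    by (auto simp: spectrahedron_def)
  ultimately show ?thesis by simp
qed

lemma convex_spectrahedron: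
  assumes "convex K"
  shows "convex (spectrahedron B\<^sub>1 B\<^sub>2 K)"
proof (rule convexI)
  fix X Y and s t :: real
  assume XY: "X \<in> spectrahedron B\<^sub>1 B\<^sub>2 K" "Y \<in> spectrahedron B\<^sub>1 B\<^sub>2 K"
    and st: "0 \<le> s" "0 \<le> t" "s + t = 1"
  have "s *\<^sub>R (B\<^sub>1 \<bullet> X, B\<^sub>2 \<bullet> X) + t *\<^sub>R (B\<^sub>1 \<bullet> Y, B\<^sub>2 \<bullet> Y) \<in> K"
    using XY st by (intro convexD[OF assms]) (auto simp: spectrahedron_def)
  then show "s *\<^sub>R X + t *\<^sub>R Y \<in> spectrahedron B\<^sub>1 B\<^sub>2 K"
    using XY st by (simp add: spectrahedron_def positive_semidefinite_add positive_semidefinite_scaleR inner_add_right)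
qed

lemma compact_spectrahedron_eq_hull:
  assumes "compact (spectrahedron B\<^sub>1 B\<^sub>2 K)" "convex K"
  shows "spectrahedron B\<^sub>1 B\<^sub>2 K = convex hull {outer x x | x. (quad_form B\<^sub>1 x, quad_form B\<^sub>2 x) \<in> K}"
    (is "?S = convex hull ?R")
proof
  have "{X. X extreme_point_of ?S} \<subseteq> ?R"
  proof
    fix X assume "X \<in> {X. X extreme_point_of ?S}"
    then have ext: "X extreme_point_of ?S" by simp
    then obtain x where x: "X = outer x x" using extreme_point_rank_one by blast
    have "X \<in> ?S" using ext by (simp add: extreme_point_of_def)
    then show "X \<in> ?R" by (auto simp: x spectrahedron_def quad_form_eq_inner_outer)
  qed
  then have "convex hull {X. X extreme_point_of ?S} \<subseteq> convex hull ?R"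
    by (rule hull_mono)
  then show "?S \<subseteq> convex hull ?R"
    using Krein_Milman_Minkowski[OF assms(1) convex_spectrahedron[OF assms(2)]] by simp
  show "convex hull ?R \<subseteq> ?S"
  proof (rule hull_minimal)
    show "?R \<subseteq> ?S"
      by (auto simp: spectrahedron_def quad_form_eq_inner_outer positive_semidefinite_outer)
    show "convex ?S" by (rule convex_spectrahedron) (rule assms(2))
  qed
qed

section \<open>Compactness from a definite combination\<close>

lemma trace_eq_inner: "trace X = mat 1 \<bullet> X"
  by (simp add: trace_def inner_vec_def mat_def if_distrib[where f="\<lambda>x. x * _"] cong: if_cong)

text \<open>By homogeneity only the slice of trace one matters. That slice is a bounded spectrahedron with
  constraint matrices \<open>I\<close> and \<open>0\<close>, so the hull theorem applies to it: positivity of \<open>N\<close> on rank-one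
  matrices spreads to the whole slice, and by compactness its minimum \<open>d\<close> there is positive. This use
  of extreme points takes the place of a spectral decomposition.\<close>

lemma positive_definite_inner_ge_trace:
  fixes N :: "real ^ 'n ^ 'n"
  assumes "\<And>x. x \<noteq> 0 \<Longrightarrow> quad_form N x > 0"
  obtains d where "d > 0" "\<And>X. positive_semidefinite X \<Longrightarrow> d * trace X \<le> N \<bullet> X"
proof -
  define S :: "(real ^ 'n ^ 'n) set" where "S = spectrahedron (mat 1) 0 {(1, 0)}"
  have S_iff: "X \<in> S \<longleftrightarrow> positive_semidefinite X \<and> trace X = 1" for X
    by (simp add: S_def spectrahedron_def trace_eq_inner)
  have "bounded S"
  proof (rule boundedI)
    fix X assume "X \<in> S"
    then show "norm X \<le> (real CARD('n))\<^sup>2"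
      using norm_le_trace[of X] by (simp add: S_iff)
  qed
  then have cS: "compact S"
    using closed_spectrahedron[of "{(1,0)}"] by (auto simp: compact_eq_bounded_closed S_def)
  have hull: "S = convex hull {outer x x | x. (quad_form (mat 1) x, quad_form 0 x) \<in> {(1, 0)}}"
    unfolding S_def by (rule compact_spectrahedron_eq_hull) (use cS in \<open>auto simp: S_def\<close>)
  have "S \<subseteq> {X. N \<bullet> X > 0}"
    unfolding hull
  proof (rule hull_minimal)
    show "convex {X. N \<bullet> X > 0}" by (rule convex_halfspace_gt)
    show "{outer x x | x. (quad_form (mat 1) x, quad_form 0 x) \<in> {(1, 0)}} \<subseteq> {X. N \<bullet> X > 0}"
    proof clarsimp
      fix x :: "real ^ 'n" assume "quad_form (mat 1) x = 1"
      then have "x \<noteq> 0" by (auto simp: quad_form_def)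
      then show "N \<bullet> outer x x > 0" using assms by (simp add: quad_form_eq_inner_outer)
    qed
  qed
  obtain d where d: "d > 0" "\<And>X. X \<in> S \<Longrightarrow> d \<le> N \<bullet> X"
  proof (cases "S = {}")
    case True then show ?thesis using that[of 1] by simp
  next
    case False
    obtain X0 where "X0 \<in> S" "\<forall>X\<in>S. N \<bullet> X0 \<le> N \<bullet> X"
      using continuous_attains_inf[OF cS False, of "\<lambda>X. N \<bullet> X"]
        continuous_on_inner[OF continuous_on_const continuous_on_id, of S N]
      by auto
    then show ?thesis using that[of "N \<bullet> X0"] \<open>S \<subseteq> _\<close> by blast
  qed
  have "d * trace X \<le> N \<bullet> X" if X: "positive_semidefinite X" for X
  proof (cases "trace X = 0")
    case True
    then have "X = 0" using norm_le_trace[OF X] by simp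
    then show ?thesis using True by simp
  next
    case False
    have "0 \<le> trace X" using positive_semidefinite_entry_le_trace[OF X] by (meson abs_ge_zero order_trans)
    with False have pos: "trace X > 0" by simp
    have "(1 / trace X) *\<^sub>R X \<in> S"
      using X pos unfolding S_iff by (simp add: positive_semidefinite_scaleR trace_eq_inner)
    from d(2)[OF this] show ?thesis using pos by (simp add: field_simps)
  qed
  with d(1) that show ?thesis by blast
qed

text \<open>The combination of the constraints with weights \<open>\<mu>\<^sub>1, \<mu>\<^sub>2\<close> bounds \<open>N \<bullet> X\<close> from above by \<open>-\<gamma>\<close>,
  where \<open>N\<close> is the negated, hence positive definite, combination of the matrices.\<close>

lemma compact_spectrahedron:
  fixes B\<^sub>1 B\<^sub>2 :: "real ^ 'n ^ 'n"
  assumes "negative_definite (\<mu>\<^sub>1 *\<^sub>R B\<^sub>1 + \<mu>\<^sub>2 *\<^sub>R B\<^sub>2)"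
    and "closed K" and lower: "\<And>s t. (s, t) \<in> K \<Longrightarrow> \<gamma> \<le> \<mu>\<^sub>1 * s + \<mu>\<^sub>2 * t"
  shows "compact (spectrahedron B\<^sub>1 B\<^sub>2 K)"
proof -
  define N where "N = - (\<mu>\<^sub>1 *\<^sub>R B\<^sub>1 + \<mu>\<^sub>2 *\<^sub>R B\<^sub>2)"
  have "quad_form N x > 0" if "x \<noteq> 0" for x
  proof -
    have "quad_form N x = - quad_form (\<mu>\<^sub>1 *\<^sub>R B\<^sub>1 + \<mu>\<^sub>2 *\<^sub>R B\<^sub>2) x"
      unfolding N_def quad_form_eq_inner_outer by (rule inner_minus_left)
    then show ?thesis using assms(1) that unfolding negative_definite_def by auto
  qed
  then obtain d where d: "d > 0" "\<And>X. positive_semidefinite X \<Longrightarrow> d * trace X \<le> N \<bullet> X"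
    using positive_definite_inner_ge_trace by blast
  have "norm X \<le> (real CARD('n))\<^sup>2 * (- \<gamma> / d)" if "X \<in> spectrahedron B\<^sub>1 B\<^sub>2 K" for X
  proof -
    have X: "positive_semidefinite X" "(B\<^sub>1 \<bullet> X, B\<^sub>2 \<bullet> X) \<in> K" using that by (auto simp: spectrahedron_def)
    have "d * trace X \<le> N \<bullet> X" using d X by blast
    also have "N \<bullet> X = - (\<mu>\<^sub>1 * (B\<^sub>1 \<bullet> X) + \<mu>\<^sub>2 * (B\<^sub>2 \<bullet> X))" by (simp add: N_def inner_add_left inner_diff_left)
    also have "\<dots> \<le> - \<gamma>" using lower[OF X(2)] by simp
    finally have "trace X \<le> - \<gamma> / d" using d(1) by (simp add: field_simps)
    with norm_le_trace[OF X(1)] show ?thesis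
      by (meson mult_left_mono order_trans zero_le_power2)
  qed
  then have "bounded (spectrahedron B\<^sub>1 B\<^sub>2 K)" by (auto simp: bounded_iff)
  then show ?thesis using closed_spectrahedron[OF assms(2)] by (simp add: compact_eq_bounded_closed)
qed

section \<open>Convex hulls of joint images of quadratic forms\<close>

text \<open>Taking convex hulls commutes with the linear map \<open>X \<mapsto> (A\<^sub>i \<bullet> X)\<^sub>i\<close>, so the description of the
  spectrahedron as a hull of rank-one matrices is carried over to its image.\<close>

theorem convex_hull_joint_quadratic_image:
  fixes A :: "'m::finite \<Rightarrow> real ^ 'n ^ 'n"
  assumes "negative_definite (\<mu>\<^sub>1 *\<^sub>R B\<^sub>1 + \<mu>\<^sub>2 *\<^sub>R B\<^sub>2)"
    and "closed K" "convex K" "\<And>s t. (s, t) \<in> K \<Longrightarrow> \<gamma> \<le> \<mu>\<^sub>1 * s + \<mu>\<^sub>2 * t"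
  shows "convex hull {(\<chi> i. quad_form (A i) x) | x. (quad_form B\<^sub>1 x, quad_form B\<^sub>2 x) \<in> K} =
    {(\<chi> i. frobenius_inner (A i) X) | X. positive_semidefinite X \<and>
       (frobenius_inner B\<^sub>1 X, frobenius_inner B\<^sub>2 X) \<in> K}"
proof -
  define L where "L X = (\<chi> i. A i \<bullet> X)" for X
  have lin: "linear L"
    by (rule linearI) (simp_all add: L_def vec_eq_iff inner_add_right)
  have "{(\<chi> i. quad_form (A i) x) | x. (quad_form B\<^sub>1 x, quad_form B\<^sub>2 x) \<in> K} =
      L ` {outer x x | x. (quad_form B\<^sub>1 x, quad_form B\<^sub>2 x) \<in> K}"
    by (auto simp: L_def quad_form_eq_inner_outer)
  then have "convex hull {(\<chi> i. quad_form (A i) x) | x. (quad_form B\<^sub>1 x, quad_form B\<^sub>2 x) \<in> K} =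
      L ` spectrahedron B\<^sub>1 B\<^sub>2 K"
    using compact_spectrahedron_eq_hull[OF compact_spectrahedron[OF assms(1,2,4)] assms(3)]
    by (simp only: convex_hull_linear_image[OF lin])
  also have "\<dots> = {(\<chi> i. frobenius_inner (A i) X) | X. positive_semidefinite X \<and>
       (frobenius_inner B\<^sub>1 X, frobenius_inner B\<^sub>2 X) \<in> K}"
    by (auto simp: L_def spectrahedron_def frobenius_inner_eq_inner)
  finally show ?thesis .
qed

text \<open>An equality constraint contributes the factor \<open>{c}\<close> to \<open>K\<close> and an inequality the factor
  \<open>{c..}\<close>; the corner \<open>(c\<^sub>1, c\<^sub>2)\<close> minimises \<open>\<mu>\<^sub>1 s + \<mu>\<^sub>2 t\<close> over \<open>K\<close> because a multiplier is
  nonnegative whenever its factor is a half-line.\<close>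

theorem theorem3p1:
  fixes A :: "'m::finite \<Rightarrow> real ^ 'n ^ 'n"
    and B\<^sub>1 B\<^sub>2 :: "real ^ 'n ^ 'n"
    and c\<^sub>1 c\<^sub>2 :: real
    and h\<^sub>1 h\<^sub>2 :: "real ^ 'n \<Rightarrow> real"
    and T :: "(real ^ 'n) set"
    and V :: "(real ^ 'm) set"
  assumes "\<And>i. symmetric_matrix (A i)"
    and "symmetric_matrix B\<^sub>1" and "symmetric_matrix B\<^sub>2"
    and "h\<^sub>1 = (\<lambda>x. quad_form B\<^sub>1 x - c\<^sub>1)"
    and "h\<^sub>2 = (\<lambda>x. quad_form B\<^sub>2 x - c\<^sub>2)"
    and "V = {(\<chi> i. quad_form (A i) x) | x. x \<in> T}"
    and "V \<noteq> {}"
  shows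
    "(T = zero_set h\<^sub>1 \<inter> zero_set h\<^sub>2 \<and>
       (\<exists>\<mu>\<^sub>1 \<mu>\<^sub>2 :: real. negative_definite (\<mu>\<^sub>1 *\<^sub>R B\<^sub>1 + \<mu>\<^sub>2 *\<^sub>R B\<^sub>2))
      \<longrightarrow> convex hull V =
        {(\<chi> i. frobenius_inner (A i) X) | X. positive_semidefinite X \<and>
            frobenius_inner B\<^sub>1 X = c\<^sub>1 \<and> frobenius_inner B\<^sub>2 X = c\<^sub>2}) \<and>
     (T = superlevel_set h\<^sub>1 \<inter> zero_set h\<^sub>2 \<and>
       (\<exists>\<mu>\<^sub>1 \<mu>\<^sub>2 :: real. \<mu>\<^sub>1 \<ge> 0 \<and> negative_definite (\<mu>\<^sub>1 *\<^sub>R B\<^sub>1 + \<mu>\<^sub>2 *\<^sub>R B\<^sub>2))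
      \<longrightarrow> convex hull V =
        {(\<chi> i. frobenius_inner (A i) X) | X. positive_semidefinite X \<and>
            frobenius_inner B\<^sub>1 X \<ge> c\<^sub>1 \<and> frobenius_inner B\<^sub>2 X = c\<^sub>2}) \<and>
     (T = zero_set h\<^sub>1 \<inter> superlevel_set h\<^sub>2 \<and>
       (\<exists>\<mu>\<^sub>1 \<mu>\<^sub>2 :: real. \<mu>\<^sub>2 \<ge> 0 \<and> negative_definite (\<mu>\<^sub>1 *\<^sub>R B\<^sub>1 + \<mu>\<^sub>2 *\<^sub>R B\<^sub>2))
      \<longrightarrow> convex hull V =
        {(\<chi> i. frobenius_inner (A i) X) | X. positive_semidefinite X \<and>
            frobenius_inner B\<^sub>1 X = c\<^sub>1 \<and> frobenius_inner B\<^sub>2 X \<ge> c\<^sub>2}) \<and>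
     (T = superlevel_set h\<^sub>1 \<inter> superlevel_set h\<^sub>2 \<and>
       (\<exists>\<mu>\<^sub>1 \<mu>\<^sub>2 :: real. \<mu>\<^sub>1 \<ge> 0 \<and> \<mu>\<^sub>2 \<ge> 0 \<and> negative_definite (\<mu>\<^sub>1 *\<^sub>R B\<^sub>1 + \<mu>\<^sub>2 *\<^sub>R B\<^sub>2))
      \<longrightarrow> convex hull V =
        {(\<chi> i. frobenius_inner (A i) X) | X. positive_semidefinite X \<and>
            frobenius_inner B\<^sub>1 X \<ge> c\<^sub>1 \<and> frobenius_inner B\<^sub>2 X \<ge> c\<^sub>2})"
proof (intro conjI impI; elim conjE exE)
  note h_defs = assms(4,5) and V_def = assms(6)
  fix \<mu>\<^sub>1 \<mu>\<^sub>2 :: real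
  assume T: "T = zero_set h\<^sub>1 \<inter> zero_set h\<^sub>2"
    and nd: "negative_definite (\<mu>\<^sub>1 *\<^sub>R B\<^sub>1 + \<mu>\<^sub>2 *\<^sub>R B\<^sub>2)"
  have "V = {(\<chi> i. quad_form (A i) x) | x. (quad_form B\<^sub>1 x, quad_form B\<^sub>2 x) \<in> {c\<^sub>1} \<times> {c\<^sub>2}}"
    by (simp add: T V_def h_defs zero_set_def superlevel_set_def)
  moreover have "\<mu>\<^sub>1 * c\<^sub>1 + \<mu>\<^sub>2 * c\<^sub>2 \<le> \<mu>\<^sub>1 * s + \<mu>\<^sub>2 * t" if "(s, t) \<in> {c\<^sub>1} \<times> {c\<^sub>2}" for s t
    using that by (auto intro!: add_mono mult_left_mono)
  ultimately show "convex hull V =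
        {(\<chi> i. frobenius_inner (A i) X) | X. positive_semidefinite X \<and>
            frobenius_inner B\<^sub>1 X = c\<^sub>1 \<and> frobenius_inner B\<^sub>2 X = c\<^sub>2}"
    using convex_hull_joint_quadratic_image[OF nd, of "{c\<^sub>1} \<times> {c\<^sub>2}"
        "\<mu>\<^sub>1 * c\<^sub>1 + \<mu>\<^sub>2 * c\<^sub>2" A]
    by (simp add: closed_Times convex_Times)
next
  note h_defs = assms(4,5) and V_def = assms(6)
  fix \<mu>\<^sub>1 \<mu>\<^sub>2 :: real
  assume T: "T = superlevel_set h\<^sub>1 \<inter> zero_set h\<^sub>2"
    and pos: "\<mu>\<^sub>1 \<ge> 0"
    and nd: "negative_definite (\<mu>\<^sub>1 *\<^sub>R B\<^sub>1 + \<mu>\<^sub>2 *\<^sub>R B\<^sub>2)"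
  have "V = {(\<chi> i. quad_form (A i) x) | x. (quad_form B\<^sub>1 x, quad_form B\<^sub>2 x) \<in> {c\<^sub>1..} \<times> {c\<^sub>2}}"
    by (simp add: T V_def h_defs zero_set_def superlevel_set_def)
  moreover have "\<mu>\<^sub>1 * c\<^sub>1 + \<mu>\<^sub>2 * c\<^sub>2 \<le> \<mu>\<^sub>1 * s + \<mu>\<^sub>2 * t" if "(s, t) \<in> {c\<^sub>1..} \<times> {c\<^sub>2}" for s t
    using that pos by (auto intro!: add_mono mult_left_mono)
  ultimately show "convex hull V =
        {(\<chi> i. frobenius_inner (A i) X) | X. positive_semidefinite X \<and>
            frobenius_inner B\<^sub>1 X \<ge> c\<^sub>1 \<and> frobenius_inner B\<^sub>2 X = c\<^sub>2}"
    using convex_hull_joint_quadratic_image[OF nd, of "{c\<^sub>1..} \<times> {c\<^sub>2}"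
        "\<mu>\<^sub>1 * c\<^sub>1 + \<mu>\<^sub>2 * c\<^sub>2" A]
    by (simp add: closed_Times convex_Times)
next
  note h_defs = assms(4,5) and V_def = assms(6)
  fix \<mu>\<^sub>1 \<mu>\<^sub>2 :: real
  assume T: "T = zero_set h\<^sub>1 \<inter> superlevel_set h\<^sub>2"
    and pos: "\<mu>\<^sub>2 \<ge> 0"
    and nd: "negative_definite (\<mu>\<^sub>1 *\<^sub>R B\<^sub>1 + \<mu>\<^sub>2 *\<^sub>R B\<^sub>2)"
  have "V = {(\<chi> i. quad_form (A i) x) | x. (quad_form B\<^sub>1 x, quad_form B\<^sub>2 x) \<in> {c\<^sub>1} \<times> {c\<^sub>2..}}"
    by (simp add: T V_def h_defs zero_set_def superlevel_set_def)
  moreover have "\<mu>\<^sub>1 * c\<^sub>1 + \<mu>\<^sub>2 * c\<^sub>2 \<le> \<mu>\<^sub>1 * s + \<mu>\<^sub>2 * t" if "(s, t) \<in> {c\<^sub>1} \<times> {c\<^sub>2..}" for s t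
    using that pos by (auto intro!: add_mono mult_left_mono)
  ultimately show "convex hull V =
        {(\<chi> i. frobenius_inner (A i) X) | X. positive_semidefinite X \<and>
            frobenius_inner B\<^sub>1 X = c\<^sub>1 \<and> frobenius_inner B\<^sub>2 X \<ge> c\<^sub>2}"
    using convex_hull_joint_quadratic_image[OF nd, of "{c\<^sub>1} \<times> {c\<^sub>2..}"
        "\<mu>\<^sub>1 * c\<^sub>1 + \<mu>\<^sub>2 * c\<^sub>2" A]
    by (simp add: closed_Times convex_Times)
next
  note h_defs = assms(4,5) and V_def = assms(6)
  fix \<mu>\<^sub>1 \<mu>\<^sub>2 :: real
  assume T: "T = superlevel_set h\<^sub>1 \<inter> superlevel_set h\<^sub>2"
    and pos: "\<mu>\<^sub>1 \<ge> 0" "\<mu>\<^sub>2 \<ge> 0"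
    and nd: "negative_definite (\<mu>\<^sub>1 *\<^sub>R B\<^sub>1 + \<mu>\<^sub>2 *\<^sub>R B\<^sub>2)"
  have "V = {(\<chi> i. quad_form (A i) x) | x. (quad_form B\<^sub>1 x, quad_form B\<^sub>2 x) \<in> {c\<^sub>1..} \<times> {c\<^sub>2..}}"
    by (simp add: T V_def h_defs zero_set_def superlevel_set_def)
  moreover have "\<mu>\<^sub>1 * c\<^sub>1 + \<mu>\<^sub>2 * c\<^sub>2 \<le> \<mu>\<^sub>1 * s + \<mu>\<^sub>2 * t" if "(s, t) \<in> {c\<^sub>1..} \<times> {c\<^sub>2..}" for s t
    using that pos by (auto intro!: add_mono mult_left_mono)
  ultimately show "convex hull V =
        {(\<chi> i. frobenius_inner (A i) X) | X. positive_semidefinite X \<and>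
            frobenius_inner B\<^sub>1 X \<ge> c\<^sub>1 \<and> frobenius_inner B\<^sub>2 X \<ge> c\<^sub>2}"
    using convex_hull_joint_quadratic_image[OF nd, of "{c\<^sub>1..} \<times> {c\<^sub>2..}"
        "\<mu>\<^sub>1 * c\<^sub>1 + \<mu>\<^sub>2 * c\<^sub>2" A]
    by (simp add: closed_Times convex_Times)
qed

end
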